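(* There is a one-to-one map between entanglement witnesses on a multipartite quantum system and the equivalence classes of Hamiltonians on that system with non-zero entanglement gap, where two Hamiltonians are regarded as equivalent if they differ only by an additive constant (a real multiple of the identity $I$). In this map, a Hamiltonian $H$ with entanglement gap $G_E>0$ defines the entanglement witness $Z_{EW}=H-E_{\mathrm{sep}}I$ (equivalent Hamiltonians defining the same witness), and every entanglement witness, regarded as a Hamiltonian, has non-zero entanglement gap.
   Context: The system has Hilbert space $\mathcal{H}_1\otimes\cdots\otimes\mathcal{H}_n$, with all $\mathcal{H}_j$ finite-dimensional, and Hamiltonians are Hermitian operators on it. A density operator $\rho$ is separable if it is a convex combination of pure product states; $\mathcal{S}$ denotes the set of all separable states, and a state that is not separable is called entangled. For a Hamiltonian $H$, the minimum separable energy is $E_{\mathrm{sep}}=\min_{\rho\in\mathcal{S}}\mathrm{tr}[H\rho]$, $E_0$ is the ground-state energy (smallest eigenvalue), and the entanglement gap is $G_E=E_{\mathrm{sep}}-E_0$. An entanglement witness is a Hermitian operator $Z_{EW}$ such that $\mathrm{tr}[Z_{EW}\rho]\ge 0$ for all $\rho\in\mathcal{S}$ and $\mathrm{tr}[Z_{EW}\rho_{\mathrm{ent}}]<0$ for some entangled state $\rho_{\mathrm{ent}}$.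
   Formalization: The map from classes to witnesses is proved one-to-one with image exactly the witnesses having minimum separable energy 0, not all witnesses: a witness Z and Z + εI for small ε > 0 can both be witnesses in one equivalence class, so the map cannot reach every witness. *)

theory Defs
  imports "Jordan_Normal_Form.Schur_Decomposition" "Jordan_Normal_Form.Spectral_Radius"
begin

text \<open>
  A multipartite system is given by the list \<open>ds = [d\<^sub>1, \<dots>, d\<^sub>n]\<close> of local dimensions: party \<open>j\<close>
  has the Hilbert space \<open>\<complex>\<^bsup>d\<^sub>j\<^esup>\<close>, and the tensor product of these spaces is identified with
  \<open>\<complex>\<^bsup>D\<^esup>\<close>, \<open>D = d\<^sub>1 \<cdots> d\<^sub>n\<close>, by the Kronecker (mixed radix) ordering of the product basis.
\<close>

definition kron_vec :: "complex vec \<Rightarrow> complex vec \<Rightarrow> complex vec" where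
  "kron_vec v w =
     vec (dim_vec v * dim_vec w) (\<lambda>i. v $ (i div dim_vec w) * w $ (i mod dim_vec w))"

definition tensor_vecs :: "complex vec list \<Rightarrow> complex vec" where
  "tensor_vecs vs = foldr kron_vec vs (vec 1 (\<lambda>_. 1))"

abbreviation total_dim :: "nat list \<Rightarrow> nat" where
  "total_dim ds \<equiv> prod_list ds"

definition mat_trace :: "complex mat \<Rightarrow> complex" where
  "mat_trace A = (\<Sum>i<dim_row A. A $$ (i, i))"

definition hermitian :: "complex mat \<Rightarrow> bool" where
  "hermitian A \<longleftrightarrow> mat_adjoint A = A"

definition hamiltonian :: "nat list \<Rightarrow> complex mat \<Rightarrow> bool" where
  "hamiltonian ds H \<longleftrightarrow> H \<in> carrier_mat (total_dim ds) (total_dim ds) \<and> hermitian H"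

definition density_operator :: "nat list \<Rightarrow> complex mat \<Rightarrow> bool" where
  "density_operator ds \<rho> \<longleftrightarrow>
     \<rho> \<in> carrier_mat (total_dim ds) (total_dim ds) \<and> hermitian \<rho> \<and>
     (\<forall>v\<in>carrier_vec (total_dim ds). 0 \<le> Re ((\<rho> *\<^sub>v v) \<bullet>c v)) \<and>
     mat_trace \<rho> = 1"

definition pure_product_vec :: "nat list \<Rightarrow> complex vec \<Rightarrow> bool" where
  "pure_product_vec ds \<psi> \<longleftrightarrow>
     (\<exists>vs. length vs = length ds \<and>
           (\<forall>j<length ds. vs ! j \<in> carrier_vec (ds ! j) \<and> vs ! j \<bullet>c vs ! j = 1) \<and>
           \<psi> = tensor_vecs vs)"

text \<open>The matrix of \<open>\<Sum>\<^sub>k p\<^sub>k |\<psi>\<^sub>k\<rangle>\<langle>\<psi>\<^sub>k|\<close> has the entries \<open>\<Sum>\<^sub>k p\<^sub>k (\<psi>\<^sub>k)\<^sub>i cnj (\<psi>\<^sub>k)\<^sub>j\<close>.\<close>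

definition separable :: "nat list \<Rightarrow> complex mat \<Rightarrow> bool" where
  "separable ds \<rho> \<longleftrightarrow>
     (\<exists>(m::nat) (p :: nat \<Rightarrow> real) (\<psi> :: nat \<Rightarrow> complex vec).
        (\<forall>k<m. 0 \<le> p k \<and> pure_product_vec ds (\<psi> k)) \<and> (\<Sum>k<m. p k) = 1 \<and>
        \<rho> = mat (total_dim ds) (total_dim ds)
              (\<lambda>(i, j). \<Sum>k<m. complex_of_real (p k) * (\<psi> k $ i * cnj (\<psi> k $ j))))"

definition entangled :: "nat list \<Rightarrow> complex mat \<Rightarrow> bool" where
  "entangled ds \<rho> \<longleftrightarrow> density_operator ds \<rho> \<and> \<not> separable ds \<rho>"

text \<open>
  For Hermitian \<open>H\<close> and \<open>\<rho>\<close> the number \<open>tr (H \<rho>)\<close> is real, so taking the real part only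
  changes the type.
\<close>

definition energy :: "complex mat \<Rightarrow> complex mat \<Rightarrow> real" where
  "energy H \<rho> = Re (mat_trace (H * \<rho>))"

text \<open>A least element, hence an attained minimum rather than an infimum.\<close>

definition E_sep :: "nat list \<Rightarrow> complex mat \<Rightarrow> real" where
  "E_sep ds H = (LEAST e. \<exists>\<rho>. separable ds \<rho> \<and> e = energy H \<rho>)"

definition E_ground :: "complex mat \<Rightarrow> real" where
  "E_ground H = Min {e. eigenvalue H (complex_of_real e)}"

definition entanglement_gap :: "nat list \<Rightarrow> complex mat \<Rightarrow> real" where
  "entanglement_gap ds H = E_sep ds H - E_ground H"

definition entanglement_witnesses :: "nat list \<Rightarrow> complex mat set" where
  "entanglement_witnesses ds =
     {Z. Z \<in> carrier_mat (total_dim ds) (total_dim ds) \<and> hermitian Z \<and>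
         (\<forall>\<rho>. separable ds \<rho> \<longrightarrow> 0 \<le> energy Z \<rho>) \<and>
         (\<exists>\<rho>. entangled ds \<rho> \<and> energy Z \<rho> < 0)}"

abbreviation scalar_op :: "nat list \<Rightarrow> real \<Rightarrow> complex mat" where
  "scalar_op ds c \<equiv> complex_of_real c \<cdot>\<^sub>m 1\<^sub>m (total_dim ds)"

definition shift_equiv :: "nat list \<Rightarrow> (complex mat \<times> complex mat) set" where
  "shift_equiv ds =
     {(H, H'). hamiltonian ds H \<and> hamiltonian ds H' \<and> (\<exists>c::real. H' = H + scalar_op ds c)}"

lemma equiv_shift_equiv: "equiv {H. hamiltonian ds H} (shift_equiv ds)"
proof (rule equivI)
  show "shift_equiv ds \<subseteq> {H. hamiltonian ds H} \<times> {H. hamiltonian ds H}"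
    by (auto simp: shift_equiv_def)
  show "refl_on {H. hamiltonian ds H} (shift_equiv ds)"
    by (auto simp: refl_on_def shift_equiv_def hamiltonian_def intro!: exI[of _ 0] eq_matI)
  show "sym (shift_equiv ds)"
  proof (rule symI)
    fix H H' assume "(H, H') \<in> shift_equiv ds"
    then obtain c where *: "hamiltonian ds H" "hamiltonian ds H'" "H' = H + scalar_op ds c"
      by (auto simp: shift_equiv_def)
    then have "H = H' + scalar_op ds (- c)"
      by (auto simp: hamiltonian_def intro!: eq_matI)
    with * show "(H', H) \<in> shift_equiv ds"
      unfolding shift_equiv_def by blast
  qed
  show "trans (shift_equiv ds)"
  proof (rule transI)
    fix H H' H'' assume "(H, H') \<in> shift_equiv ds" "(H', H'') \<in> shift_equiv ds"
    then obtain c c' where *: "hamiltonian ds H" "hamiltonian ds H''"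
        "H'' = H + scalar_op ds c + scalar_op ds c'"
      by (auto simp: shift_equiv_def)
    then have "H'' = H + scalar_op ds (c + c')"
      by (auto simp: hamiltonian_def intro!: eq_matI)
    with * show "(H, H'') \<in> shift_equiv ds"
      unfolding shift_equiv_def by blast
  qed
qed

text \<open>The gap is invariant under shifts, so a class is gapped as soon as one member is.\<close>

definition gapped_classes :: "nat list \<Rightarrow> complex mat set set" where
  "gapped_classes ds = {H. hamiltonian ds H \<and> entanglement_gap ds H \<noteq> 0} // shift_equiv ds"

text \<open>
  A witness may have strictly positive energy on all separable states; it then differs by a
  positive shift from the witness \<open>H - E\<^sub>s\<^sub>e\<^sub>p I\<close> of its class. So the map from classes to
  witnesses is injective, and its range consists of the following normalised witnesses.
\<close>

definition normalised_witnesses :: "nat list \<Rightarrow> complex mat set" where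
  "normalised_witnesses ds = {Z \<in> entanglement_witnesses ds. E_sep ds Z = 0}"

end

theory Submission
  imports Defs "HOL-Analysis.Function_Topology"
begin

text \<open>
  Both energies are minima of the Rayleigh quotient \<open>\<langle>v, H v\<rangle>\<close>: by linearity the minimal separable
  energy is the minimum over product vectors, attained by Tychonoff compactness, and the
  ground-state energy is the minimum over all unit vectors. Hence the gap is non-negative and
  invariant under shifts, and if it is positive the ground-state projector is an entangled state
  with negative energy for \<open>H - E\<^sub>s\<^sub>e\<^sub>p I\<close>. Conversely \<open>tr (H \<rho>) \<ge> E\<^sub>0\<close> for all states \<open>\<rho>\<close>, because
  the trace of a product of positive semidefinite matrices is non-negative; so a witness has
  \<open>E\<^sub>0 < 0 \<le> E\<^sub>s\<^sub>e\<^sub>p\<close>.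
\<close>

subsection \<open>Quadratic forms and positive semidefinite matrices\<close>

text \<open>The form <x, A x>, stated for functions instead of matrices: passing to the leading
  block in an induction on the dimension then only changes \<open>n\<close>.\<close>

definition qform :: "nat \<Rightarrow> (nat \<Rightarrow> nat \<Rightarrow> complex) \<Rightarrow> (nat \<Rightarrow> complex) \<Rightarrow> complex" where
  "qform n A x = (\<Sum>i<n. \<Sum>j<n. A i j * (x j * cnj (x i)))"

text \<open>Splits off the last index. By symmetry the last column is the conjugate of the last row,
  so both cross terms are governed by the single number \<open>s x\<close>.\<close>

lemma qform_Suc:
  assumes herm: "\<And>i j. i < Suc n \<Longrightarrow> j < Suc n \<Longrightarrow> A j i = cnj (A i j)"
  defines "s \<equiv> \<lambda>x. \<Sum>j<n. A n j * x j"
  shows "qform (Suc n) A x =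
    qform n A x + x n * cnj (s x) + cnj (x n) * s x + A n n * (x n * cnj (x n))"
proof -
  have "(\<Sum>i<n. A i n * (x n * cnj (x i))) = x n * cnj (s x)"
  proof -
    have "A i n = cnj (A n i)" if "i < n" for i
      using herm[of n i] that by simp
    then show ?thesis
      by (auto simp: s_def sum_distrib_left mult_ac intro!: sum.cong)
  qed
  moreover have "(\<Sum>j<n. A n j * (x j * cnj (x n))) = cnj (x n) * s x"
    by (simp add: s_def sum_distrib_left mult_ac)
  ultimately show ?thesis
    by (simp add: qform_def sum.distrib algebra_simps)
qed

lemma qform_cong:
  assumes "\<And>i. i < n \<Longrightarrow> x i = y i"
  shows "qform n A x = qform n A y"
  using assms by (simp add: qform_def)

text \<open>Each step splits off the rank-one part through the last basis vector; what remains is the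
  Schur complement, whose form is the minimum of the old form over the last coordinate.\<close>

lemma psd_sum_rank_one:
  assumes "\<And>i j. i < n \<Longrightarrow> j < n \<Longrightarrow> A j i = cnj (A i j)"
    and "\<And>x. 0 \<le> Re (qform n A x)"
  shows "\<exists>(m::nat) a. \<forall>i<n. \<forall>j<n. A i j = (\<Sum>k<m. a k i * cnj (a k j))"
  using assms
proof (induction n arbitrary: A)
  case 0
  then show ?case by simp
next
  case (Suc n)
  note herm = Suc.prems(1) and psd = Suc.prems(2)
  define s where "s = (\<lambda>x. \<Sum>j<n. A n j * x j)"
  have expand: "qform (Suc n) A (x(n := c)) =
      qform n A x + c * cnj (s x) + cnj c * s x + A n n * (c * cnj c)" for x c
  proof -
    have "s (x(n := c)) = s x"
      by (simp add: s_def)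
    moreover have "qform n A (x(n := c)) = qform n A x"
      by (rule qform_cong) simp
    ultimately show ?thesis
      using qform_Suc[OF herm, where x = "x(n := c)"] by (simp add: s_def)
  qed
  define r where "r = Re (A n n)"
  have d: "A n n = of_real r"
    using arg_cong[OF herm[of n n], of Im] by (simp add: r_def complex_eq_iff)
  have "0 \<le> Re (qform (Suc n) A ((\<lambda>_. 0)(n := 1)))"
    by (rule psd)
  then have r0: "0 \<le> r"
    by (simp only: expand) (simp add: qform_def s_def d)
  \<comment> \<open>With a zero corner entry the form is affine in the multiple of
    \<open>s x\<close> placed in the last coordinate, so it can stay non-negative only if the last
    row vanishes.\<close>
  have col: "A n j = 0" if "r = 0" "j < n" for j
  proof -
    have "s x = 0" for x
    proof (rule ccontr)
      assume "s x \<noteq> 0"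
      then have pos: "(cmod (s x))\<^sup>2 > 0" by simp
      \<comment> \<open>Chosen so that the form takes the value -1.\<close>
      define t where "t = (Re (qform n A x) + 1) / (2 * (cmod (s x))\<^sup>2)"
      have "0 \<le> Re (qform (Suc n) A (x(n := - of_real t * s x)))"
        by (rule psd)
      also have "\<dots> = Re (qform n A x) - 2 * t * (cmod (s x))\<^sup>2"
        unfolding expand d that(1)
        by (simp add: cmod_power2) (simp add: power2_eq_square algebra_simps)
      also have "\<dots> = -1"
        using pos by (simp add: t_def field_simps)
      finally show False by simp
    qed
    from this[of "\<lambda>i. if i = j then 1 else 0"] show ?thesis
      using that(2) by (simp add: s_def if_distrib cong: if_cong)
  qed
  \<comment> \<open>For \<open>r = 0\<close> the quotient is 0 by the convention for division, so
    \<open>A'\<close> is then \<open>A\<close> on all indices and needs no separate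
    definition.\<close>
  define A' where "A' = (\<lambda>i j. A i j - A i n * A n j / A n n)"
  have qA': "qform n A' x = qform n A x - cnj (s x) * s x / A n n" for x
  proof -
    have "A i n = cnj (A n i)" if "i < n" for i
      using herm[of n i] that by simp
    then have "(\<Sum>i<n. \<Sum>j<n. A i n * A n j / A n n * (x j * cnj (x i)))
        = (\<Sum>i<n. cnj (A n i) * cnj (x i)) * (\<Sum>j<n. A n j * x j) / A n n"
      unfolding sum_product sum_divide_distrib
      by (intro sum.cong refl) (simp add: mult_ac)
    also have "\<dots> = cnj (s x) * s x / A n n"
      by (simp add: s_def)
    finally show ?thesis
      unfolding qform_def A'_def by (simp add: left_diff_distrib sum_subtractf)
  qed
  have "0 \<le> Re (qform n A' x)" for x
  proof -
    \<comment> \<open>Completing the square puts the minimum over the last coordinate at -s/r. For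
      \<open>r = 0\<close> this reads 0, which again gives the form of \<open>A'\<close>.\<close>
    have "0 \<le> Re (qform (Suc n) A (x(n := - s x / of_real r)))"
      by (rule psd)
    also have "qform (Suc n) A (x(n := - s x / of_real r)) = qform n A' x"
      by (cases "r = 0") (simp_all add: expand qA' d)
    finally show ?thesis .
  qed
  moreover have "A' j i = cnj (A' i j)" if "i < n" "j < n" for i j
    using that herm[of i j] herm[of i n] herm[of n j] d by (simp add: A'_def mult.commute)
  ultimately obtain m :: nat and a where
    a: "\<And>i j. i < n \<Longrightarrow> j < n \<Longrightarrow> A' i j = (\<Sum>k<m. a k i * cnj (a k j))"
    using Suc.IH[of A'] by blast
  \<comment> \<open>The vectors from the smaller block are extended by 0, and the last column over
    sqrt r is appended; for \<open>r = 0\<close> the appended vector is zero.\<close>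
  define b where "b = (\<lambda>k i. if k < m then (if i < n then a k i else 0)
                               else A i n / of_real (sqrt r))"
  have bm: "b m i * cnj (b m j) = A i n * A n j / A n n" if "i < Suc n" "j < Suc n" for i j
  proof -
    have "complex_of_real (sqrt r) * complex_of_real (sqrt r) = of_real r"
      using r0 by (metis of_real_mult real_sqrt_mult_self abs_of_nonneg)
    moreover have "A n j = cnj (A j n)"
      using herm[of j n] that by simp
    ultimately show ?thesis
      by (simp add: b_def d)
  qed
  have "A i j = (\<Sum>k<Suc m. b k i * cnj (b k j))" if "i < Suc n" "j < Suc n" for i j
  proof (cases "i < n \<and> j < n")
    case True
    then have "(\<Sum>k<m. b k i * cnj (b k j)) = A' i j"
      using a by (simp add: b_def)
    then show ?thesis
      using bm[OF that] by (simp add: A'_def)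
  next
    case False
    then have z: "(\<Sum>k<m. b k i * cnj (b k j)) = 0"
      by (auto simp: b_def)
    \<comment> \<open>In the last row and column the appended rank-one term must supply the whole
      entry. For \<open>r = 0\<close> both sides vanish, by \<open>col\<close> and Hermitian
      symmetry.\<close>
    have "A i j = A i n * A n j / A n n"
    proof (cases "r = 0")
      case True
      have "A i n = 0" if "i < n" for i
        using col[OF True that] herm[of n i] that by simp
      with False that col[OF True] d True show ?thesis
        by (auto simp: less_Suc_eq)
    next
      case False
      with \<open>\<not> (i < n \<and> j < n)\<close> that d show ?thesis
        by (auto simp: less_Suc_eq)
    qed
    with z bm[OF that] show ?thesis by simp
  qed
  then show ?case by blast
qed

text \<open>Writing A as a sum of rank-one terms \<open>a k\<close> turns the trace of A B into the
  sum of the values of the form of B at the vectors \<open>a k\<close>.\<close>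

lemma psd_trace_product_nonneg:
  assumes "\<And>i j. i < n \<Longrightarrow> j < n \<Longrightarrow> A j i = cnj (A i j)"
    and "\<And>x. 0 \<le> Re (qform n A x)"
    and "\<And>x. 0 \<le> Re (qform n B x)"
  shows "0 \<le> Re (\<Sum>i<n. \<Sum>j<n. A i j * B j i)"
proof -
  obtain m :: nat and a where
    a: "\<And>i j. i < n \<Longrightarrow> j < n \<Longrightarrow> A i j = (\<Sum>k<m. a k i * cnj (a k j))"
    using psd_sum_rank_one[of n A] assms(1,2) by blast
  have "(\<Sum>i<n. \<Sum>j<n. A i j * B j i) = (\<Sum>i<n. \<Sum>j<n. \<Sum>k<m. B j i * (a k i * cnj (a k j)))"
    using a by (simp add: sum_distrib_left mult.commute)
  also have "\<dots> = (\<Sum>j<n. \<Sum>i<n. \<Sum>k<m. B j i * (a k i * cnj (a k j)))"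
    by (rule sum.swap)
  also have "\<dots> = (\<Sum>j<n. \<Sum>k<m. \<Sum>i<n. B j i * (a k i * cnj (a k j)))"
    by (intro sum.cong refl sum.swap)
  also have "\<dots> = (\<Sum>k<m. qform n B (a k))"
    unfolding qform_def by (rule sum.swap)
  finally show ?thesis
    using assms(3) by (simp add: sum_nonneg)
qed

text \<open>With A a sum of rank-one terms, the form at x is the sum of |<a_k, x>|^2. If it
  vanishes, so does each <a_k, x>, and A x is a combination of the a_k with exactly these
  coefficients. This later shows that a minimiser of the form is an eigenvector.\<close>

lemma psd_kernel:
  assumes "\<And>i j. i < n \<Longrightarrow> j < n \<Longrightarrow> A j i = cnj (A i j)"
    and "\<And>x. 0 \<le> Re (qform n A x)"
    and "Re (qform n A x) = 0" and "i < n"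
  shows "(\<Sum>j<n. A i j * x j) = 0"
proof -
  obtain m :: nat and a where
    a: "\<And>i j. i < n \<Longrightarrow> j < n \<Longrightarrow> A i j = (\<Sum>k<m. a k i * cnj (a k j))"
    using psd_sum_rank_one[of n A] assms(1,2) by blast
  define c where "c = (\<lambda>k. \<Sum>j<n. cnj (a k j) * x j)"
  have row: "(\<Sum>j<n. A i j * x j) = (\<Sum>k<m. a k i * c k)" if "i < n" for i
  proof -
    have "(\<Sum>j<n. A i j * x j) = (\<Sum>j<n. \<Sum>k<m. a k i * (cnj (a k j) * x j))"
      using a that by (simp add: sum_distrib_right mult.assoc)
    also have "\<dots> = (\<Sum>k<m. \<Sum>j<n. a k i * (cnj (a k j) * x j))"
      by (rule sum.swap)
    finally show ?thesis
      by (simp add: c_def sum_distrib_left)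
  qed
  have "qform n A x = (\<Sum>i<n. cnj (x i) * (\<Sum>j<n. A i j * x j))"
    by (simp add: qform_def sum_distrib_left mult_ac)
  also have "\<dots> = (\<Sum>i<n. \<Sum>k<m. cnj (x i) * (a k i * c k))"
    using row by (simp add: sum_distrib_left)
  also have "\<dots> = (\<Sum>k<m. \<Sum>i<n. cnj (x i) * (a k i * c k))"
    by (rule sum.swap)
  also have "\<dots> = (\<Sum>k<m. cnj (c k) * c k)"
    by (simp add: c_def sum_distrib_left sum_distrib_right mult_ac)
  also have "\<dots> = of_real (\<Sum>k<m. (cmod (c k))\<^sup>2)"
    by (simp add: complex_norm_square mult.commute del: of_real_power)
  finally have "(\<Sum>k<m. (cmod (c k))\<^sup>2) = 0"
    using assms(3) by simp
  then have "c k = 0" if "k < m" for k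
    using that by (simp add: sum_nonneg_eq_0_iff)
  then show ?thesis
    using row[OF assms(4)] by simp
qed

subsection \<open>Product vectors\<close>

text \<open>The mixed radix bijection from i to (i div b, i mod b) splits the index range into
  \<open>a\<close> blocks of length \<open>b\<close>. This makes inner products multiplicative under
  \<open>kron_vec\<close>.\<close>

lemma sum_div_mod:
  fixes f g :: "nat \<Rightarrow> 'a::comm_semiring_0"
  shows "(\<Sum>i<a * b. f (i div b) * g (i mod b)) = (\<Sum>i<a. f i) * (\<Sum>j<b. g j)"
proof -
  have "(\<Sum>i<a * b. f (i div b) * g (i mod b))
      = (\<Sum>m<a. \<Sum>i\<in>{m * b..<m * b + b}. f (i div b) * g (i mod b))"
    by (simp add: sum.nat_group)
  also have "\<dots> = (\<Sum>m<a. \<Sum>j<b. f m * g j)"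
  proof (rule sum.cong[OF refl])
    fix m
    have "(\<Sum>i\<in>{m * b..<m * b + b}. f (i div b) * g (i mod b))
        = (\<Sum>j\<in>{0..<b}. f ((j + m * b) div b) * g ((j + m * b) mod b))"
      using sum.shift_bounds_nat_ivl[of "\<lambda>i. f (i div b) * g (i mod b)" 0 "m * b" b]
      by (simp add: add.commute)
    also have "\<dots> = (\<Sum>j<b. f m * g j)"
      by (auto simp: atLeast0LessThan intro!: sum.cong)
    finally show "(\<Sum>i\<in>{m * b..<m * b + b}. f (i div b) * g (i mod b)) = (\<Sum>j<b. f m * g j)" .
  qed
  finally show ?thesis
    by (simp add: sum_product)
qed

lemma cscalar_self: "v \<bullet>c v = (\<Sum>i<dim_vec v. v $ i * cnj (v $ i))" for v :: "complex vec"
  by (simp add: scalar_prod_def atLeast0LessThan)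

lemma dim_kron_vec [simp]: "dim_vec (kron_vec v w) = dim_vec v * dim_vec w"
  by (simp add: kron_vec_def)

lemma kron_vec_cscalar_self: "kron_vec v w \<bullet>c kron_vec v w = (v \<bullet>c v) * (w \<bullet>c w)"
proof -
  have "kron_vec v w \<bullet>c kron_vec v w = (\<Sum>i<dim_vec v * dim_vec w.
      (v $ (i div dim_vec w) * cnj (v $ (i div dim_vec w))) *
      (w $ (i mod dim_vec w) * cnj (w $ (i mod dim_vec w))))"
    unfolding cscalar_self by (auto simp: kron_vec_def mult_ac intro!: sum.cong)
  also have "\<dots> = (v \<bullet>c v) * (w \<bullet>c w)"
    unfolding cscalar_self by (rule sum_div_mod)
  finally show ?thesis .
qed

lemma tensor_vecs_simps [simp]:
  "tensor_vecs [] = vec 1 (\<lambda>_. 1)"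
  "tensor_vecs (v # vs) = kron_vec v (tensor_vecs vs)"
  by (simp_all add: tensor_vecs_def)

lemma dim_tensor_vecs: "dim_vec (tensor_vecs vs) = prod_list (map dim_vec vs)"
  by (induction vs) simp_all

lemma tensor_vecs_cscalar_self:
  "tensor_vecs vs \<bullet>c tensor_vecs vs = prod_list (map (\<lambda>v. v \<bullet>c v) vs)"
proof (induction vs)
  case Nil
  show ?case by (simp add: cscalar_self)
next
  case (Cons v vs)
  then show ?case by (simp add: kron_vec_cscalar_self)
qed

lemma prod_list_eq_1: "\<forall>x\<in>set xs. x = 1 \<Longrightarrow> prod_list xs = (1::'a::monoid_mult)"
  by (induction xs) simp_all

lemma pure_product_vec_carrier:
  assumes "pure_product_vec ds \<psi>"
  shows "\<psi> \<in> carrier_vec (total_dim ds)"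
proof -
  obtain vs where vs: "length vs = length ds" "\<forall>j<length ds. vs ! j \<in> carrier_vec (ds ! j)"
      "\<psi> = tensor_vecs vs"
    using assms by (auto simp: pure_product_vec_def)
  then have "map dim_vec vs = ds"
    by (auto intro: nth_equalityI)
  then show ?thesis
    using vs(3) by (intro carrier_vecI) (simp add: dim_tensor_vecs)
qed

lemma pure_product_vec_unit:
  assumes "pure_product_vec ds \<psi>"
  shows "\<psi> \<bullet>c \<psi> = 1"
proof -
  obtain vs where vs: "length vs = length ds" "\<forall>j<length ds. vs ! j \<bullet>c vs ! j = 1"
      "\<psi> = tensor_vecs vs"
    using assms by (auto simp: pure_product_vec_def)
  then have "v \<bullet>c v = 1" if "v \<in> set vs" for v
    using that by (auto simp: in_set_conv_nth)
  then show ?thesis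
    unfolding vs(3) tensor_vecs_cscalar_self by (intro prod_list_eq_1) simp
qed

text \<open>Lets every result about product vectors be applied to arbitrary unit vectors. The
  trailing one-dimensional factor of \<open>tensor_vecs\<close> is neutral for
  \<open>kron_vec\<close>.\<close>

lemma pure_product_vec_single:
  "pure_product_vec [d] v \<longleftrightarrow> v \<in> carrier_vec d \<and> v \<bullet>c v = 1"
proof -
  have "kron_vec w (vec 1 (\<lambda>_. 1)) = w" for w
    by (intro eq_vecI) (auto simp: kron_vec_def)
  then show ?thesis
    by (auto simp: pure_product_vec_def length_Suc_conv)
qed

section \<open>Attainment of the minimum over product vectors\<close>

definition rayleigh :: "complex mat \<Rightarrow> complex vec \<Rightarrow> real" where
  "rayleigh H v = Re (qform (dim_row H) (\<lambda>i j. H $$ (i, j)) (\<lambda>i. v $ i))"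

lemma continuous_on_coordinate2:
  "continuous_on S (\<lambda>f::'i \<Rightarrow> 'j \<Rightarrow> 'a::topological_space. f j i)"
proof -
  have "continuous_on S (\<lambda>f::'i \<Rightarrow> 'j \<Rightarrow> 'a. f j)"
    by (rule continuous_on_subset[OF continuous_on_product_coordinates]) simp
  then show ?thesis
    by (rule continuous_on_product_then_coordinatewise)
qed

text \<open>Induction on the list of parties: an entry of the tensor product is a coordinate of the
  first local vector times an entry of the tensor product of the others.\<close>

lemma continuous_on_tensor_vecs:
  fixes d :: "'i \<Rightarrow> nat"
  assumes "i < prod_list (map d js)"
  shows "continuous_on UNIV
    (\<lambda>f::'i \<Rightarrow> nat \<Rightarrow> complex. tensor_vecs (map (\<lambda>j. vec (d j) (f j)) js) $ i)"
  using assms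
proof (induction js arbitrary: i)
  case Nil
  then show ?case by simp
next
  case (Cons j js)
  define w where "w = prod_list (map d js)"
  have i: "i < d j * w"
    using Cons.prems by (simp add: w_def)
  then have w: "w > 0"
    by (cases "w = 0") auto
  have dw: "dim_vec (tensor_vecs (map (\<lambda>j. vec (d j) (f j)) js)) = w" for f :: "'i \<Rightarrow> nat \<Rightarrow> complex"
    by (simp add: dim_tensor_vecs w_def o_def)
  have "continuous_on UNIV (\<lambda>f::'i \<Rightarrow> nat \<Rightarrow> complex. f j (i div w))"
    by (rule continuous_on_coordinate2)
  moreover have "continuous_on UNIV
      (\<lambda>f::'i \<Rightarrow> nat \<Rightarrow> complex. tensor_vecs (map (\<lambda>j. vec (d j) (f j)) js) $ (i mod w))"
    by (rule Cons.IH) (use w in \<open>simp add: w_def\<close>)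
  moreover have "i div w < d j"
    using i by (simp add: less_mult_imp_div_less)
  ultimately show ?case
    using i by (simp add: kron_vec_def dw continuous_on_mult)
qed

text \<open>Tuples of local vectors are coded as functions
  \<open>nat \<Rightarrow> nat \<Rightarrow> complex\<close> with the product topology. The box
  \<open>B\<close> is compact by Tychonoff, the normalisation conditions \<open>S\<close> are
  closed, and \<open>F\<close> maps the intersection continuously onto the product vectors.\<close>

lemma pure_product_vec_minimiser:
  assumes ds: "\<forall>d\<in>set ds. d \<ge> 1" and H: "H \<in> carrier_mat (total_dim ds) (total_dim ds)"
  obtains \<psi> where "pure_product_vec ds \<psi>"
    and "\<And>\<phi>. pure_product_vec ds \<phi> \<Longrightarrow> rayleigh H \<psi> \<le> rayleigh H \<phi>"
proof -
  \<comment> \<open>A square containing the unit disc, hence all coordinates of unit vectors.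
    Coordinates outside the system are also kept in it, so that the box is compact.\<close>
  define Q where "Q = {z. \<bar>Re z\<bar> \<le> 1 \<and> \<bar>Im z\<bar> \<le> 1}"
  define B where "B = (\<Pi>\<^sub>E j\<in>(UNIV::nat set). \<Pi>\<^sub>E i\<in>(UNIV::nat set). Q)"
  define S where "S = {f::nat \<Rightarrow> nat \<Rightarrow> complex.
      \<forall>j\<in>{..<length ds}. (\<Sum>i<ds ! j. f j i * cnj (f j i)) = 1}"
  define F where "F = (\<lambda>f::nat \<Rightarrow> nat \<Rightarrow> complex.
      tensor_vecs (map (\<lambda>j. vec (ds ! j) (f j)) [0..<length ds]))"
  have "compact Q"
  proof -
    have "Q = (\<lambda>p. of_real (fst p) + \<i> * of_real (snd p)) ` ({-1..1} \<times> {-1..1})"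
    proof
      show "Q \<subseteq> (\<lambda>p. of_real (fst p) + \<i> * of_real (snd p)) ` ({-1..1} \<times> {-1..1})"
      proof
        fix z assume "z \<in> Q"
        then have "z = (\<lambda>p. of_real (fst p) + \<i> * of_real (snd p)) (Re z, Im z)"
          and "(Re z, Im z) \<in> {-1..1} \<times> {-1..1}"
          by (auto simp: Q_def complex_eq_iff)
        then show "z \<in> (\<lambda>p. of_real (fst p) + \<i> * of_real (snd p)) ` ({-1..1} \<times> {-1..1})"
          by (rule image_eqI)
      qed
    qed (auto simp: Q_def)
    then show ?thesis
      by (simp add: compact_continuous_image compact_Times continuous_on_add continuous_on_mult
          continuous_on_of_real continuous_on_fst continuous_on_snd continuous_on_id)
  qed
  then have "compact B"
  proof -
    have "compactin (product_topology (\<lambda>j. product_topology (\<lambda>i. euclidean) UNIV) UNIV) B"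
      unfolding B_def compactin_PiE using \<open>compact Q\<close> by simp
    then show ?thesis
      by (simp add: euclidean_product_topology)
  qed
  moreover have "closed S"
    unfolding S_def Collect_ball_eq
    by (intro closed_INT ballI closed_Collect_eq continuous_on_sum continuous_on_mult
        continuous_on_cnj continuous_on_const continuous_on_coordinate2)
  ultimately have "compact (B \<inter> S)"
    by (rule compact_Int_closed)
  \<comment> \<open>The first basis vector of each party shows non-emptiness; it exists because
    local dimensions are positive.\<close>
  moreover have "(\<lambda>j i. if i = 0 then 1 else 0) \<in> B \<inter> S"
  proof -
    have "(\<Sum>i<ds ! j. (if i = 0 then 1 else 0) * cnj (if i = 0 then 1 else 0)) = 1"
      if "j < length ds" for j
    proof -
      have "0 < ds ! j"
        using ds that by (metis less_eq_Suc_le nth_mem One_nat_def)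
      then show ?thesis
        by (simp add: if_distrib cong: if_cong)
    qed
    then show ?thesis
      by (simp add: B_def S_def Q_def PiE_iff)
  qed
  moreover have "continuous_on (B \<inter> S) (\<lambda>f. rayleigh H (F f))"
  proof -
    have "continuous_on UNIV (\<lambda>f. F f $ i)" if "i < total_dim ds" for i
      unfolding F_def by (rule continuous_on_tensor_vecs) (use that in \<open>simp add: map_nth\<close>)
    then have "continuous_on UNIV (\<lambda>f. rayleigh H (F f))"
      unfolding rayleigh_def qform_def using H
      by (intro continuous_on_Re continuous_on_sum continuous_on_mult continuous_on_const
          continuous_on_cnj) auto
    then show ?thesis
      by (rule continuous_on_subset) simp
  qed
  ultimately obtain f where f: "f \<in> B \<inter> S"
    and fmin: "\<And>g. g \<in> B \<inter> S \<Longrightarrow> rayleigh H (F f) \<le> rayleigh H (F g)"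
    using continuous_attains_inf[of "B \<inter> S" "\<lambda>f. rayleigh H (F f)"] by blast
  have "pure_product_vec ds (F f)"
    unfolding pure_product_vec_def F_def
    by (rule exI[of _ "map (\<lambda>j. vec (ds ! j) (f j)) [0..<length ds]"])
      (use f in \<open>auto simp: S_def cscalar_self\<close>)
  moreover have "\<exists>g\<in>B \<inter> S. F g = \<phi>" if "pure_product_vec ds \<phi>" for \<phi>
  proof -
    obtain vs where vs: "length vs = length ds" "\<phi> = tensor_vecs vs"
        "\<And>j. j < length ds \<Longrightarrow> vs ! j \<in> carrier_vec (ds ! j)"
        "\<And>j. j < length ds \<Longrightarrow> vs ! j \<bullet>c vs ! j = 1"
      using \<open>pure_product_vec ds \<phi>\<close> by (auto simp: pure_product_vec_def)
    \<comment> \<open>Padding by 0 keeps the coordinates outside the system in the box.\<close>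
    define g where "g = (\<lambda>j i. if j < length ds \<and> i < ds ! j then vs ! j $ i else 0)"
    have unit: "(\<Sum>i<ds ! j. g j i * cnj (g j i)) = 1" if "j < length ds" for j
      using vs(3,4)[OF that] that by (simp add: cscalar_self g_def)
    have "cmod (g j i) \<le> 1" for j i
    proof (cases "j < length ds \<and> i < ds ! j")
      case True
      have "complex_of_real (\<Sum>i<ds ! j. (cmod (g j i))\<^sup>2) = of_real 1"
        using unit True by (simp add: complex_norm_square del: of_real_power)
      then have "(\<Sum>i<ds ! j. (cmod (g j i))\<^sup>2) = 1"
        by (simp only: of_real_eq_iff)
      moreover have "(cmod (g j i))\<^sup>2 \<le> (\<Sum>i<ds ! j. (cmod (g j i))\<^sup>2)"
        by (rule member_le_sum) (use True in auto)
      ultimately show ?thesis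
        by (simp add: power_le_one_iff)
    next
      case False
      then show ?thesis by (auto simp: g_def)
    qed
    then have "g \<in> B \<inter> S"
      using unit order_trans[OF abs_Re_le_cmod] order_trans[OF abs_Im_le_cmod]
      by (simp add: B_def S_def Q_def PiE_iff)
    moreover have "map (\<lambda>j. vec (ds ! j) (g j)) [0..<length ds] = vs"
    proof (rule nth_equalityI)
      fix j assume "j < length (map (\<lambda>j. vec (ds ! j) (g j)) [0..<length ds])"
      then have j: "j < length ds" by simp
      then have "vec (ds ! j) (g j) = vs ! j"
        using vs(3)[OF j] by (intro eq_vecI) (auto simp: g_def)
      then show "map (\<lambda>j. vec (ds ! j) (g j)) [0..<length ds] ! j = vs ! j"
        using j by simp
    qed (simp add: vs(1))
    ultimately show ?thesis
      using vs(2) by (auto simp: F_def)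
  qed
  ultimately show thesis
    using that fmin by metis
qed

subsection \<open>Energies\<close>

lemma qform_shift:
  "qform n (\<lambda>i j. A i j - (if i = j then c else 0)) x
    = qform n A x - c * (\<Sum>i<n. x i * cnj (x i))"
proof -
  have "(\<Sum>j<n. (if i = j then c else 0) * (x j * cnj (x i))) = c * (x i * cnj (x i))"
    if "i < n" for i
    using that by (simp add: if_distrib[of "\<lambda>a. a * _"] cong: if_cong)
  then show ?thesis
    by (simp add: qform_def left_diff_distrib sum_subtractf sum_distrib_left)
qed

lemma mult_mat_vec_cscalar:
  assumes "A \<in> carrier_mat n n" "v \<in> carrier_vec n"
  shows "(A *\<^sub>v v) \<bullet>c v = qform n (\<lambda>i j. A $$ (i, j)) (\<lambda>i. v $ i)"
  using assms by (auto simp: qform_def scalar_prod_def atLeast0LessThan sum_distrib_right mult.assoc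
      intro!: sum.cong)

lemma cscalar_self_real: "v \<bullet>c v = of_real (\<Sum>i<dim_vec v. (cmod (v $ i))\<^sup>2)"
  by (simp add: cscalar_self complex_norm_square del: of_real_power)

lemma hermitian_iff:
  assumes "A \<in> carrier_mat n n"
  shows "hermitian A \<longleftrightarrow> (\<forall>i<n. \<forall>j<n. A $$ (j, i) = cnj (A $$ (i, j)))"
proof -
  have dim: "dim_row (mat_adjoint A) = n" "dim_col (mat_adjoint A) = n"
    and ix: "\<And>i j. i < n \<Longrightarrow> j < n \<Longrightarrow> mat_adjoint A $$ (j, i) = cnj (A $$ (i, j))"
    using assms by (simp_all add: mat_adjoint_def mat_of_rows_def)
  have "hermitian A \<longleftrightarrow> (\<forall>i<n. \<forall>j<n. mat_adjoint A $$ (j, i) = A $$ (j, i))"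
    unfolding hermitian_def mat_eq_iff using assms dim by auto
  also have "\<dots> \<longleftrightarrow> (\<forall>i<n. \<forall>j<n. cnj (A $$ (i, j)) = A $$ (j, i))"
    using ix by (metis (no_types))
  finally show ?thesis
    by (metis (no_types))
qed

lemma hermitianD:
  assumes "hermitian A" "A \<in> carrier_mat n n" "i < n" "j < n"
  shows "A $$ (j, i) = cnj (A $$ (i, j))"
  using assms hermitian_iff by blast

lemma hamiltonian_shift:
  assumes "hamiltonian ds H"
  shows "hamiltonian ds (H + scalar_op ds c)"
proof -
  have H: "H \<in> carrier_mat (total_dim ds) (total_dim ds)" "hermitian H"
    using assms by (auto simp: hamiltonian_def)
  have "(H + scalar_op ds c) $$ (j, i) = cnj ((H + scalar_op ds c) $$ (i, j))"
    if "i < total_dim ds" "j < total_dim ds" for i j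
    using H(1) hermitianD[OF H(2,1) that] that by simp
  then have "hermitian (H + scalar_op ds c)"
    using H(1) by (intro hermitian_iff[THEN iffD2, of _ "total_dim ds"] allI impI) auto
  then show ?thesis
    using H by (simp add: hamiltonian_def)
qed

lemma minus_scalar_op:
  assumes "H \<in> carrier_mat (total_dim ds) (total_dim ds)"
  shows "H - scalar_op ds c = H + scalar_op ds (- c)"
  using assms by (intro eq_matI) auto

lemma rayleigh_shift:
  assumes "H \<in> carrier_mat (total_dim ds) (total_dim ds)"
    and "v \<in> carrier_vec (total_dim ds)" "v \<bullet>c v = 1"
  shows "rayleigh (H + scalar_op ds c) v = rayleigh H v + c"
proof -
  let ?n = "total_dim ds"
  have "qform ?n (\<lambda>i j. (H + scalar_op ds c) $$ (i, j)) (\<lambda>i. v $ i)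
      = qform ?n (\<lambda>i j. H $$ (i, j) - (if i = j then of_real (- c) else 0)) (\<lambda>i. v $ i)"
    using assms(1) unfolding qform_def by (intro sum.cong refl) auto
  also have "\<dots> = qform ?n (\<lambda>i j. H $$ (i, j)) (\<lambda>i. v $ i) + of_real c * (v \<bullet>c v)"
    using assms(2) unfolding qform_shift by (simp add: cscalar_self)
  finally show ?thesis
    using assms by (simp add: rayleigh_def)
qed

text \<open>The vectors are left arbitrary, so the same construction covers separable states and the
  projector onto an entangled ground state.\<close>

definition mixture ::
  "nat \<Rightarrow> nat \<Rightarrow> (nat \<Rightarrow> real) \<Rightarrow> (nat \<Rightarrow> complex vec) \<Rightarrow> complex mat" where
  "mixture n m p \<psi> =
    mat n n (\<lambda>(i, j). \<Sum>k<m. complex_of_real (p k) * (\<psi> k $ i * cnj (\<psi> k $ j)))"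

lemma separable_iff_mixture:
  "separable ds \<rho> \<longleftrightarrow>
    (\<exists>m p \<psi>. (\<forall>k<m. 0 \<le> p k \<and> pure_product_vec ds (\<psi> k)) \<and> (\<Sum>k<m. p k) = 1 \<and>
      \<rho> = mixture (total_dim ds) m p \<psi>)"
  by (simp add: separable_def mixture_def)

lemma energy_eq_sum:
  assumes "H \<in> carrier_mat n n" "\<rho> \<in> carrier_mat n n"
  shows "energy H \<rho> = Re (\<Sum>i<n. \<Sum>j<n. H $$ (i, j) * \<rho> $$ (j, i))"
  using assms by (simp add: energy_def mat_trace_def scalar_prod_def atLeast0LessThan)

text \<open>Linearity of the trace. For convex weights the energy is an average of the values
  \<open>rayleigh H (\<psi> k)\<close>, which reduces minimisation over separable states to product
  vectors.\<close>

lemma energy_mixture: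
  assumes "H \<in> carrier_mat n n"
  shows "energy H (mixture n m p \<psi>) = (\<Sum>k<m. p k * rayleigh H (\<psi> k))"
proof -
  have "(\<Sum>i<n. \<Sum>j<n. H $$ (i, j) * mixture n m p \<psi> $$ (j, i))
      = (\<Sum>i<n. \<Sum>j<n. \<Sum>k<m. of_real (p k) * (H $$ (i, j) * (\<psi> k $ j * cnj (\<psi> k $ i))))"
    by (simp add: mixture_def sum_distrib_left mult_ac)
  also have "\<dots> = (\<Sum>i<n. \<Sum>k<m. \<Sum>j<n. of_real (p k) * (H $$ (i, j) * (\<psi> k $ j * cnj (\<psi> k $ i))))"
    by (intro sum.cong refl sum.swap)
  also have "\<dots> = (\<Sum>k<m. \<Sum>i<n. \<Sum>j<n. of_real (p k) * (H $$ (i, j) * (\<psi> k $ j * cnj (\<psi> k $ i))))"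
    by (rule sum.swap)
  also have "\<dots> = (\<Sum>k<m. of_real (p k) * qform n (\<lambda>i j. H $$ (i, j)) (\<lambda>i. \<psi> k $ i))"
    by (simp add: qform_def sum_distrib_left)
  finally have "energy H (mixture n m p \<psi>)
      = Re (\<Sum>k<m. of_real (p k) * qform n (\<lambda>i j. H $$ (i, j)) (\<lambda>i. \<psi> k $ i))"
    using assms by (subst energy_eq_sum[of _ n]) (simp_all add: mixture_def)
  then show ?thesis
    using assms by (simp add: rayleigh_def)
qed

text \<open>The form of the projector at w is |<w, v>|^2, and its trace is the squared norm of
  v.\<close>

lemma density_operator_pure:
  assumes "v \<in> carrier_vec (total_dim ds)" "v \<bullet>c v = 1"
  shows "density_operator ds (mixture (total_dim ds) 1 (\<lambda>_. 1) (\<lambda>_. v))"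
proof -
  define n where "n = total_dim ds"
  define \<rho> where "\<rho> = mixture n 1 (\<lambda>_. 1) (\<lambda>_. v)"
  have \<rho>: "\<rho> \<in> carrier_mat n n"
    by (simp add: \<rho>_def mixture_def)
  have ix: "\<rho> $$ (i, j) = v $ i * cnj (v $ j)" if "i < n" "j < n" for i j
    using that by (simp add: \<rho>_def mixture_def)
  have "hermitian \<rho>"
    unfolding hermitian_iff[OF \<rho>] using ix by (simp add: mult.commute)
  moreover have "0 \<le> Re ((\<rho> *\<^sub>v w) \<bullet>c w)" if "w \<in> carrier_vec n" for w
  proof -
    define s where "s = (\<Sum>i<n. v $ i * cnj (w $ i))"
    have "(\<rho> *\<^sub>v w) \<bullet>c w = (\<Sum>i<n. \<Sum>j<n. (v $ i * cnj (w $ i)) * cnj (v $ j * cnj (w $ j)))"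
      unfolding mult_mat_vec_cscalar[OF \<rho> that] qform_def using ix
      by (intro sum.cong refl) (simp add: mult_ac)
    also have "\<dots> = s * cnj s"
      by (simp add: s_def sum_product)
    finally show ?thesis
      by simp
  qed
  moreover have "mat_trace \<rho> = 1"
    using \<rho> ix assms by (simp add: mat_trace_def cscalar_self n_def)
  ultimately show ?thesis
    using \<rho> by (simp add: density_operator_def \<rho>_def n_def)
qed

subsection \<open>Minimal separable energy and ground-state energy\<close>

text \<open>The \<open>LEAST\<close> in \<open>E_sep\<close> has a known value only once a minimum
  is attained. The projector onto the minimising product vector attains it, since the energy of any
  separable state is an average over product vectors.\<close>

lemma E_sep_minimiser:
  assumes ds: "\<forall>d\<in>set ds. d \<ge> 1" and H: "H \<in> carrier_mat (total_dim ds) (total_dim ds)"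
  obtains \<psi> \<rho> where "pure_product_vec ds \<psi>" "rayleigh H \<psi> = E_sep ds H"
    and "separable ds \<rho>" "energy H \<rho> = E_sep ds H"
    and "\<And>\<phi>. pure_product_vec ds \<phi> \<Longrightarrow> E_sep ds H \<le> rayleigh H \<phi>"
    and "\<And>\<sigma>. separable ds \<sigma> \<Longrightarrow> E_sep ds H \<le> energy H \<sigma>"
proof -
  obtain \<psi> where \<psi>: "pure_product_vec ds \<psi>"
    and min: "\<And>\<phi>. pure_product_vec ds \<phi> \<Longrightarrow> rayleigh H \<psi> \<le> rayleigh H \<phi>"
    using pure_product_vec_minimiser[OF ds H] by blast
  define \<rho> where "\<rho> = mixture (total_dim ds) 1 (\<lambda>_. 1) (\<lambda>_. \<psi>)"
  have \<rho>: "separable ds \<rho>"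
    unfolding separable_iff_mixture \<rho>_def using \<psi>
    by (intro exI[of _ 1] exI[of _ "\<lambda>_. 1"] exI[of _ "\<lambda>_. \<psi>"]) simp
  have e\<rho>: "energy H \<rho> = rayleigh H \<psi>"
    by (simp add: \<rho>_def energy_mixture[OF H])
  have le: "rayleigh H \<psi> \<le> energy H \<sigma>" if \<sigma>: "separable ds \<sigma>" for \<sigma>
  proof -
    obtain m p \<phi> where p: "\<forall>k<m. 0 \<le> p k \<and> pure_product_vec ds (\<phi> k)" "(\<Sum>k<m. p k) = 1"
        "\<sigma> = mixture (total_dim ds) m p \<phi>"
      using \<sigma> unfolding separable_iff_mixture by blast
    have "rayleigh H \<psi> = (\<Sum>k<m. p k * rayleigh H \<psi>)"
      using p(2) by (simp flip: sum_distrib_right)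
    also have "\<dots> \<le> (\<Sum>k<m. p k * rayleigh H (\<phi> k))"
      using p(1) min by (intro sum_mono mult_left_mono) auto
    also have "\<dots> = energy H \<sigma>"
      by (simp add: p(3) energy_mixture[OF H])
    finally show ?thesis .
  qed
  have "E_sep ds H = rayleigh H \<psi>"
    unfolding E_sep_def
  proof (rule Least_equality)
    show "\<exists>\<rho>. separable ds \<rho> \<and> rayleigh H \<psi> = energy H \<rho>"
      using \<rho> e\<rho> by metis
  next
    fix e assume "\<exists>\<rho>. separable ds \<rho> \<and> e = energy H \<rho>"
    then show "rayleigh H \<psi> \<le> e"
      using le by blast
  qed
  with \<psi> \<rho> e\<rho> min le that show thesis
    by metis
qed

text \<open>The form moves by c at every product vector, so the minimiser of either problem competes
  in the other, giving both inequalities.\<close>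

lemma E_sep_shift:
  assumes ds: "\<forall>d\<in>set ds. d \<ge> 1" and H: "H \<in> carrier_mat (total_dim ds) (total_dim ds)"
  shows "E_sep ds (H + scalar_op ds c) = E_sep ds H + c"
proof -
  have H': "H + scalar_op ds c \<in> carrier_mat (total_dim ds) (total_dim ds)"
    using H by simp
  have shift: "rayleigh (H + scalar_op ds c) \<psi> = rayleigh H \<psi> + c"
    if "pure_product_vec ds \<psi>" for \<psi>
    using rayleigh_shift[OF H] pure_product_vec_carrier[OF that] pure_product_vec_unit[OF that]
    by blast
  obtain \<psi> where \<psi>: "pure_product_vec ds \<psi>" "rayleigh H \<psi> = E_sep ds H"
      "\<And>\<phi>. pure_product_vec ds \<phi> \<Longrightarrow> E_sep ds H \<le> rayleigh H \<phi>"
    using E_sep_minimiser[OF ds H] by metis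
  obtain \<psi>' where \<psi>': "pure_product_vec ds \<psi>'"
      "rayleigh (H + scalar_op ds c) \<psi>' = E_sep ds (H + scalar_op ds c)"
      "\<And>\<phi>. pure_product_vec ds \<phi> \<Longrightarrow>
        E_sep ds (H + scalar_op ds c) \<le> rayleigh (H + scalar_op ds c) \<phi>"
    using E_sep_minimiser[OF ds H'] by metis
  show ?thesis
    using \<psi>(2) \<psi>(3)[OF \<psi>'(1)] \<psi>'(2) \<psi>'(3)[OF \<psi>(1)] shift[OF \<psi>(1)] shift[OF \<psi>'(1)] by linarith
qed

text \<open>By homogeneity it suffices to bound the form at unit vectors, which are the product
  vectors of a single party.\<close>

lemma psd_minus_E_sep_single:
  assumes n: "n \<ge> 1" and H: "H \<in> carrier_mat n n"
  shows "0 \<le> Re (qform n (\<lambda>i j. H $$ (i, j) - (if i = j then of_real (E_sep [n] H) else 0)) x)"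
proof -
  define N where "N = (\<Sum>i<n. (cmod (x i))\<^sup>2)"
  have N: "(\<Sum>i<n. x i * cnj (x i)) = of_real N"
    by (simp add: N_def complex_norm_square del: of_real_power)
  have "E_sep [n] H * N \<le> Re (qform n (\<lambda>i j. H $$ (i, j)) x)"
  proof (cases "N = 0")
    case True
    then have "x i = 0" if "i < n" for i
      using that by (simp add: N_def sum_nonneg_eq_0_iff)
    then show ?thesis
      using True by (simp add: qform_def)
  next
    case False
    then have pos: "N > 0"
      using sum_nonneg[of "{..<n}" "\<lambda>i. (cmod (x i))\<^sup>2"] by (simp add: N_def)
    define w where "w = vec n (\<lambda>i. x i / of_real (sqrt N))"
    have sq: "complex_of_real (sqrt N) * complex_of_real (sqrt N) = of_real N"
      using pos by (simp flip: of_real_mult)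
    have "w \<bullet>c w = (\<Sum>i<n. x i * cnj (x i)) / of_real N"
      by (simp add: cscalar_self w_def sq sum_divide_distrib)
    then have "pure_product_vec [n] w"
      using pos by (simp add: pure_product_vec_single w_def N)
    then have "E_sep [n] H \<le> rayleigh H w"
      using E_sep_minimiser[of "[n]" H] n H by auto
    also have "qform n (\<lambda>i j. H $$ (i, j)) (\<lambda>i. w $ i)
        = qform n (\<lambda>i j. H $$ (i, j)) x / of_real N"
      by (simp add: qform_def w_def sq sum_divide_distrib)
    then have "rayleigh H w = Re (qform n (\<lambda>i j. H $$ (i, j)) x) / N"
      using H by (simp add: rayleigh_def)
    finally show ?thesis
      using pos by (simp add: field_simps)
  qed
  then show ?thesis
    unfolding qform_shift N by simp
qed

text \<open>The unit vectors of \<open>\<complex>\<^sup>n\<close> are the product vectors of a one-party system, so the variational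
  characterisation of the ground-state energy is an instance of the theory of \<open>E_sep\<close>.\<close>

lemma E_ground_eq_E_sep_single:
  assumes n: "n \<ge> 1" and H: "H \<in> carrier_mat n n" and herm: "hermitian H"
  shows "E_ground H = E_sep [n] H"
proof -
  define e where "e = E_sep [n] H"
  define A where "A = (\<lambda>i j. H $$ (i, j) - (if i = j then complex_of_real e else 0))"
  have psd: "0 \<le> Re (qform n A x)" for x
    unfolding A_def e_def by (rule psd_minus_E_sep_single[OF n H])
  have A_herm: "A j i = cnj (A i j)" if "i < n" "j < n" for i j
    using hermitianD[OF herm H that] by (simp add: A_def)
  have "\<forall>d\<in>set [n]. d \<ge> 1" "H \<in> carrier_mat (total_dim [n]) (total_dim [n])"
    using n H by simp_all
  then obtain v where v: "pure_product_vec [n] v" "rayleigh H v = e"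
    unfolding e_def using E_sep_minimiser by metis
  then have v': "v \<in> carrier_vec n" "v \<bullet>c v = 1"
    by (simp_all add: pure_product_vec_single)
  have "qform n A (\<lambda>i. v $ i) = qform n (\<lambda>i j. H $$ (i, j)) (\<lambda>i. v $ i) - of_real e * (v \<bullet>c v)"
    unfolding A_def qform_shift using v'(1) by (simp add: cscalar_self)
  then have "Re (qform n A (\<lambda>i. v $ i)) = 0"
    using v(2) v'(2) H by (simp add: rayleigh_def)
  \<comment> \<open>The form of H - e I is non-negative and vanishes at the minimiser v, so v lies
    in its kernel and is an eigenvector of H for e.\<close>
  then have ker: "(\<Sum>j<n. A i j * v $ j) = 0" if "i < n" for i
    using psd_kernel[of n A "\<lambda>i. v $ i" i] A_herm psd that by blast
  have row: "(\<Sum>j<n. A i j * w $ j) = (\<Sum>j<n. H $$ (i, j) * w $ j) - of_real e * w $ i"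
    if "i < n" for i and w :: "complex vec"
    using that
    by (simp add: A_def left_diff_distrib sum_subtractf if_distrib[of "\<lambda>a. a * _"] cong: if_cong)
  have "eigenvalue H (of_real e)"
    unfolding eigenvalue_def eigenvector_def
  proof (intro exI conjI)
    show "v \<in> carrier_vec (dim_row H)"
      using v' H by simp
    show "v \<noteq> 0\<^sub>v (dim_row H)"
      using v'(2) by auto
    show "H *\<^sub>v v = of_real e \<cdot>\<^sub>v v"
    proof (rule eq_vecI)
      fix i assume "i < dim_vec (of_real e \<cdot>\<^sub>v v)"
      then have i: "i < n" using v' by simp
      then show "(H *\<^sub>v v) $ i = (of_real e \<cdot>\<^sub>v v) $ i"
        using ker[OF i] row[OF i, of v] H v'(1) by (simp add: scalar_prod_def atLeast0LessThan)
    qed (use H v' in simp)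
  qed
  \<comment> \<open>At an eigenvector for e' the form of H - e I equals (e' - e) times the squared
    norm, and it is non-negative.\<close>
  moreover have "e \<le> e'" if "eigenvalue H (of_real e')" for e'
  proof -
    obtain w where w: "w \<in> carrier_vec n" "w \<noteq> 0\<^sub>v n" "H *\<^sub>v w = of_real e' \<cdot>\<^sub>v w"
      using \<open>eigenvalue H (of_real e')\<close> H by (auto simp: eigenvalue_def eigenvector_def)
    define N where "N = (\<Sum>i<n. (cmod (w $ i))\<^sup>2)"
    have N: "w \<bullet>c w = of_real N"
      using w(1) by (simp only: cscalar_self_real N_def) simp
    have "w \<bullet>c w \<noteq> 0"
      using w by (simp add: conjugate_square_eq_0_vec)
    then have "N \<noteq> 0"
      using N by simp
    then have pos: "N > 0"
      using sum_nonneg[of "{..<n}" "\<lambda>i. (cmod (w $ i))\<^sup>2"] by (simp add: N_def)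
    have "qform n (\<lambda>i j. H $$ (i, j)) (\<lambda>i. w $ i) = of_real e' * (w \<bullet>c w)"
      using mult_mat_vec_cscalar[OF H w(1)] w by simp
    then have "qform n A (\<lambda>i. w $ i) = of_real ((e' - e) * N)"
      unfolding A_def qform_shift using w(1) N by (simp add: cscalar_self algebra_simps)
    then have "0 \<le> (e' - e) * N"
      using psd[of "\<lambda>i. w $ i"] by simp
    then show ?thesis
      using pos by (simp add: zero_le_mult_iff)
  qed
  \<comment> \<open>\<open>Min\<close> is meaningful only on a finite set; the set of real
    eigenvalues inherits finiteness from the spectrum.\<close>
  moreover have "finite {x. eigenvalue H (complex_of_real x)}"
  proof -
    have "finite (complex_of_real -` spectrum H)"
      using card_finite_spectrum(1)[OF H] by (intro finite_vimageI) (auto simp: inj_def)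
    then show ?thesis
      by (simp add: spectrum_def vimage_def)
  qed
  ultimately have "Min {x. eigenvalue H (complex_of_real x)} = e"
    by (intro Min_eqI) auto
  then show ?thesis
    by (simp add: E_ground_def e_def)
qed

subsection \<open>Witnesses and gapped Hamiltonians\<close>

lemma E_ground_le_energy:
  assumes n: "total_dim ds \<ge> 1" and H: "hamiltonian ds H" and \<rho>: "density_operator ds \<rho>"
  shows "E_ground H \<le> energy H \<rho>"
proof -
  define n where "n = total_dim ds"
  define e where "e = E_sep [n] H"
  define A where "A = (\<lambda>i j. H $$ (i, j) - (if i = j then complex_of_real e else 0))"
  have n': "n \<ge> 1"
    using n by (simp add: n_def)
  have Hc: "H \<in> carrier_mat n n" "hermitian H"
    using H by (simp_all add: hamiltonian_def n_def)
  have \<rho>c: "\<rho> \<in> carrier_mat n n" "mat_trace \<rho> = 1"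
    and pos: "\<And>v. v \<in> carrier_vec n \<Longrightarrow> 0 \<le> Re ((\<rho> *\<^sub>v v) \<bullet>c v)"
    using \<rho> by (simp_all add: density_operator_def n_def)
  have "0 \<le> Re (qform n (\<lambda>i j. \<rho> $$ (i, j)) x)" for x
  proof -
    have "qform n (\<lambda>i j. \<rho> $$ (i, j)) x = (\<rho> *\<^sub>v vec n x) \<bullet>c vec n x"
      by (subst mult_mat_vec_cscalar[OF \<rho>c(1)]) (auto intro: qform_cong)
    then show ?thesis
      using pos by simp
  qed
  moreover have "0 \<le> Re (qform n A x)" for x
    unfolding A_def e_def by (rule psd_minus_E_sep_single[OF n' Hc(1)])
  moreover have "A j i = cnj (A i j)" if "i < n" "j < n" for i j
    using hermitianD[OF Hc(2,1) that] by (simp add: A_def)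
  ultimately have "0 \<le> Re (\<Sum>i<n. \<Sum>j<n. A i j * \<rho> $$ (j, i))"
    using psd_trace_product_nonneg[of n A "\<lambda>i j. \<rho> $$ (i, j)"] by blast
  \<comment> \<open>The shift by e contributes e times the trace of the state, which is 1.\<close>
  also have "(\<Sum>i<n. \<Sum>j<n. A i j * \<rho> $$ (j, i))
      = (\<Sum>i<n. \<Sum>j<n. H $$ (i, j) * \<rho> $$ (j, i)) - of_real e * mat_trace \<rho>"
    using \<rho>c(1) by (simp add: A_def left_diff_distrib sum_subtractf mat_trace_def
        sum_distrib_left if_distrib[of "\<lambda>a. a * _"] cong: if_cong)
  finally have "e \<le> energy H \<rho>"
    using energy_eq_sum[OF Hc(1) \<rho>c(1)] \<rho>c(2) by simp
  then show ?thesis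
    using E_ground_eq_E_sep_single[OF n' Hc] by (simp add: e_def)
qed

lemma total_dim_pos:
  assumes "\<forall>d\<in>set ds. d \<ge> (1::nat)"
  shows "total_dim ds \<ge> 1"
  using assms by (induction ds) auto

text \<open>A product vector is in particular a unit vector of the whole space, so it competes in
  the minimum that defines the ground-state energy of the one-party system.\<close>

lemma entanglement_gap_nonneg:
  assumes ds: "\<forall>d\<in>set ds. d \<ge> 1" and H: "hamiltonian ds H"
  shows "entanglement_gap ds H \<ge> 0"
proof -
  let ?n = "total_dim ds"
  have n: "?n \<ge> 1"
    using total_dim_pos[OF ds] .
  have Hc: "H \<in> carrier_mat ?n ?n" "hermitian H"
    using H by (simp_all add: hamiltonian_def)
  obtain \<psi> where \<psi>: "pure_product_vec ds \<psi>" "rayleigh H \<psi> = E_sep ds H"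
    using E_sep_minimiser[OF ds Hc(1)] by metis
  have "pure_product_vec [?n] \<psi>"
    using pure_product_vec_carrier[OF \<psi>(1)] pure_product_vec_unit[OF \<psi>(1)]
    by (simp add: pure_product_vec_single)
  moreover have "\<forall>d\<in>set [?n]. d \<ge> 1" "H \<in> carrier_mat (total_dim [?n]) (total_dim [?n])"
    using n Hc by simp_all
  ultimately have "E_sep [?n] H \<le> rayleigh H \<psi>"
    using E_sep_minimiser by metis
  then show ?thesis
    using \<psi>(2) E_ground_eq_E_sep_single[OF n Hc] by (simp add: entanglement_gap_def)
qed

lemma E_sep_nonneg_witness:
  assumes ds: "\<forall>d\<in>set ds. d \<ge> 1" and Z: "Z \<in> entanglement_witnesses ds"
  shows "E_sep ds Z \<ge> 0"
proof -
  have Zc: "Z \<in> carrier_mat (total_dim ds) (total_dim ds)"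
    and pos: "\<And>\<rho>. separable ds \<rho> \<Longrightarrow> 0 \<le> energy Z \<rho>"
    using Z by (auto simp: entanglement_witnesses_def)
  show ?thesis
    using E_sep_minimiser[OF ds Zc] pos by metis
qed

lemma entanglement_witness_gap:
  assumes ds: "\<forall>d\<in>set ds. d \<ge> 1" and Z: "Z \<in> entanglement_witnesses ds"
  shows "hamiltonian ds Z" and "entanglement_gap ds Z > 0"
proof -
  show H: "hamiltonian ds Z"
    using Z by (simp add: entanglement_witnesses_def hamiltonian_def)
  obtain \<rho> where "density_operator ds \<rho>" "energy Z \<rho> < 0"
    using Z by (auto simp: entanglement_witnesses_def entangled_def)
  then have "E_ground Z < 0"
    using E_ground_le_energy[OF total_dim_pos[OF ds] H] by fastforce
  then show "entanglement_gap ds Z > 0"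
    using E_sep_nonneg_witness[OF ds Z] by (simp add: entanglement_gap_def)
qed

lemma normalised_witness_of_gapped:
  assumes ds: "\<forall>d\<in>set ds. d \<ge> 1" and H: "hamiltonian ds H" and gap: "entanglement_gap ds H > 0"
  shows "H - scalar_op ds (E_sep ds H) \<in> normalised_witnesses ds"
proof -
  define Z where "Z = H + scalar_op ds (- E_sep ds H)"
  let ?n = "total_dim ds"
  have n: "?n \<ge> 1"
    using total_dim_pos[OF ds] .
  have Hc: "H \<in> carrier_mat ?n ?n" "hermitian H"
    using H by (simp_all add: hamiltonian_def)
  have "hamiltonian ds Z"
    unfolding Z_def by (rule hamiltonian_shift[OF H])
  then have Zc: "Z \<in> carrier_mat ?n ?n" "hermitian Z"
    by (simp_all add: hamiltonian_def)
  have E0: "E_sep ds Z = 0"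
    unfolding Z_def E_sep_shift[OF ds Hc(1)] by simp
  have sep: "0 \<le> energy Z \<rho>" if "separable ds \<rho>" for \<rho>
    using E_sep_minimiser[OF ds Zc(1)] that E0 by metis
  have "\<forall>d\<in>set [?n]. d \<ge> 1" "H \<in> carrier_mat (total_dim [?n]) (total_dim [?n])"
    using n Hc by simp_all
  \<comment> \<open>A minimiser over all unit vectors of the whole space, that is, a ground-state
    vector.\<close>
  then obtain v where v: "pure_product_vec [?n] v" "rayleigh H v = E_sep [?n] H"
    using E_sep_minimiser by metis
  then have v': "v \<in> carrier_vec ?n" "v \<bullet>c v = 1"
    by (simp_all add: pure_product_vec_single)
  define \<rho> where "\<rho> = mixture ?n 1 (\<lambda>_. 1) (\<lambda>_. v)"
  have "energy Z \<rho> = rayleigh Z v"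
    by (simp add: \<rho>_def energy_mixture[OF Zc(1)])
  also have "\<dots> = rayleigh H v - E_sep ds H"
    unfolding Z_def rayleigh_shift[OF Hc(1) v'] by simp
  also have "\<dots> = - entanglement_gap ds H"
    using v(2) E_ground_eq_E_sep_single[OF n Hc] by (simp add: entanglement_gap_def)
  finally have neg: "energy Z \<rho> < 0"
    using gap by simp
  \<comment> \<open>Entanglement of the ground state comes for free: its energy is minus the gap,
    whereas separable states have non-negative energy for Z.\<close>
  then have "\<not> separable ds \<rho>"
    using sep[of \<rho>] by linarith
  then have "entangled ds \<rho>"
    unfolding entangled_def using density_operator_pure[OF v'] by (simp add: \<rho>_def)
  with neg sep Zc E0 have "Z \<in> normalised_witnesses ds"
    by (auto simp: normalised_witnesses_def entanglement_witnesses_def)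
  then show ?thesis
    by (simp add: Z_def minus_scalar_op[OF Hc(1)])
qed

text \<open>One direction makes the map well defined on classes, the other makes it injective. A
  shift by c moves \<open>E_sep\<close> by c and cancels; conversely, equal witnesses leave only the
  difference of the two separable energies.\<close>

lemma shift_equiv_iff_witness_eq:
  assumes ds: "\<forall>d\<in>set ds. d \<ge> 1" and H: "hamiltonian ds H" and H': "hamiltonian ds H'"
  shows "(H, H') \<in> shift_equiv ds \<longleftrightarrow>
    H - scalar_op ds (E_sep ds H) = H' - scalar_op ds (E_sep ds H')"
proof -
  have Hc: "H \<in> carrier_mat (total_dim ds) (total_dim ds)"
    "H' \<in> carrier_mat (total_dim ds) (total_dim ds)"
    using H H' by (simp_all add: hamiltonian_def)
  show ?thesis
  proof
    assume "(H, H') \<in> shift_equiv ds"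
    then obtain c where c: "H' = H + scalar_op ds c"
      by (auto simp: shift_equiv_def)
    have "H - scalar_op ds e = H + scalar_op ds c - scalar_op ds (e + c)" for e
      using Hc(1) by (intro eq_matI) auto
    then show "H - scalar_op ds (E_sep ds H) = H' - scalar_op ds (E_sep ds H')"
      unfolding c E_sep_shift[OF ds Hc(1)] .
  next
    assume eq: "H - scalar_op ds (E_sep ds H) = H' - scalar_op ds (E_sep ds H')"
    have "H' = H' - scalar_op ds (E_sep ds H') + scalar_op ds (E_sep ds H')"
      using Hc(2) by (intro eq_matI) auto
    also have "\<dots> = H + scalar_op ds (E_sep ds H' - E_sep ds H)"
      unfolding eq[symmetric] using Hc(1) by (intro eq_matI) auto
    finally show "(H, H') \<in> shift_equiv ds"
      unfolding shift_equiv_def using H H' by blast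
  qed
qed

section \<open>The bijection between gapped classes and normalised witnesses\<close>

theorem mainTheorem2:
  fixes ds :: "nat list"
  assumes "ds \<noteq> []" and "\<forall>d\<in>set ds. d \<ge> 1"
  shows "(\<exists>\<Phi> :: complex mat set \<Rightarrow> complex mat.
            (\<forall>H. hamiltonian ds H \<and> entanglement_gap ds H > 0 \<longrightarrow>
                 \<Phi> (shift_equiv ds `` {H}) = H - scalar_op ds (E_sep ds H)) \<and>
            \<Phi> ` gapped_classes ds \<subseteq> entanglement_witnesses ds \<and>
            inj_on \<Phi> (gapped_classes ds) \<and>
            \<Phi> ` gapped_classes ds = normalised_witnesses ds)
         \<and> (\<forall>Z\<in>entanglement_witnesses ds. hamiltonian ds Z \<and> entanglement_gap ds Z \<noteq> 0)"
proof
  note ds = assms(2)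
  define W where "W = (\<lambda>H. H - scalar_op ds (E_sep ds H))"
  \<comment> \<open>The choice of representative is harmless, because \<open>W\<close> is constant
    on each class.\<close>
  define \<Phi> where "\<Phi> = (\<lambda>C. W (SOME H. H \<in> C))"
  have \<Phi>: "\<Phi> (shift_equiv ds `` {H}) = W H" if H: "hamiltonian ds H" for H
  proof -
    have "H \<in> shift_equiv ds `` {H}"
      using equiv_class_self[OF equiv_shift_equiv] H by simp
    then have "(SOME H'. H' \<in> shift_equiv ds `` {H}) \<in> shift_equiv ds `` {H}"
      by (rule someI)
    moreover have "W H' = W H" if "H' \<in> shift_equiv ds `` {H}" for H'
    proof -
      have "(H, H') \<in> shift_equiv ds"
        using that by (simp only: Image_singleton_iff)
      moreover from this have "hamiltonian ds H'"
        by (simp add: shift_equiv_def)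
      ultimately show ?thesis
        using shift_equiv_iff_witness_eq[OF ds H] by (simp add: W_def)
    qed
    ultimately show ?thesis
      unfolding \<Phi>_def by blast
  qed
  \<comment> \<open>Non-negativity of the gap turns the non-zero gap in
    \<open>gapped_classes\<close> into a positive one.\<close>
  have gapped: "\<exists>H. C = shift_equiv ds `` {H} \<and> hamiltonian ds H \<and> entanglement_gap ds H > 0"
    if C: "C \<in> gapped_classes ds" for C
  proof -
    obtain H where "C = shift_equiv ds `` {H}" "hamiltonian ds H" "entanglement_gap ds H \<noteq> 0"
      using C by (auto simp: gapped_classes_def quotient_def)
    then show ?thesis
      using entanglement_gap_nonneg[OF ds] by force
  qed
  have sub: "\<Phi> ` gapped_classes ds \<subseteq> normalised_witnesses ds"
  proof
    fix Z assume "Z \<in> \<Phi> ` gapped_classes ds"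
    then obtain H where "hamiltonian ds H" "entanglement_gap ds H > 0"
        "Z = \<Phi> (shift_equiv ds `` {H})"
      using gapped by blast
    then show "Z \<in> normalised_witnesses ds"
      using normalised_witness_of_gapped[OF ds] by (simp add: \<Phi> W_def)
  qed
  \<comment> \<open>A normalised witness, read as a Hamiltonian, is gapped and its class is the
    preimage: its separable energy is 0, so \<open>W\<close> fixes it.\<close>
  have sup: "normalised_witnesses ds \<subseteq> \<Phi> ` gapped_classes ds"
  proof
    fix Z assume "Z \<in> normalised_witnesses ds"
    then have Z: "Z \<in> entanglement_witnesses ds" "E_sep ds Z = 0"
      by (simp_all add: normalised_witnesses_def)
    note gZ = entanglement_witness_gap[OF ds Z(1)]
    then have "shift_equiv ds `` {Z} \<in> gapped_classes ds"
      unfolding gapped_classes_def by (intro quotientI) simp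
    moreover have "W Z = Z"
      using gZ(1) unfolding W_def Z(2) hamiltonian_def by (intro eq_matI) auto
    then have "\<Phi> (shift_equiv ds `` {Z}) = Z"
      using \<Phi>[OF gZ(1)] by simp
    ultimately show "Z \<in> \<Phi> ` gapped_classes ds"
      by (metis imageI)
  qed
  have "inj_on \<Phi> (gapped_classes ds)"
  proof (rule inj_onI)
    fix C C' assume "C \<in> gapped_classes ds" "C' \<in> gapped_classes ds" and eq: "\<Phi> C = \<Phi> C'"
    then obtain H H' where H: "C = shift_equiv ds `` {H}" "hamiltonian ds H"
        "C' = shift_equiv ds `` {H'}" "hamiltonian ds H'"
      using gapped by meson
    then have "W H = W H'"
      using eq \<Phi> by simp
    then have "(H, H') \<in> shift_equiv ds"
      using shift_equiv_iff_witness_eq[OF ds H(2,4)] by (simp add: W_def)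
    then show "C = C'"
      unfolding H by (rule equiv_class_eq[OF equiv_shift_equiv])
  qed
  moreover have "\<forall>H. hamiltonian ds H \<and> entanglement_gap ds H > 0 \<longrightarrow>
      \<Phi> (shift_equiv ds `` {H}) = H - scalar_op ds (E_sep ds H)"
    using \<Phi> by (simp add: W_def)
  moreover have "normalised_witnesses ds \<subseteq> entanglement_witnesses ds"
    by (auto simp: normalised_witnesses_def)
  ultimately show "\<exists>\<Phi> :: complex mat set \<Rightarrow> complex mat.
            (\<forall>H. hamiltonian ds H \<and> entanglement_gap ds H > 0 \<longrightarrow>
                 \<Phi> (shift_equiv ds `` {H}) = H - scalar_op ds (E_sep ds H)) \<and>
            \<Phi> ` gapped_classes ds \<subseteq> entanglement_witnesses ds \<and>
            inj_on \<Phi> (gapped_classes ds) \<and>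
            \<Phi> ` gapped_classes ds = normalised_witnesses ds"
    using sub sup by (intro exI[of _ \<Phi>] conjI) auto
next
  show "\<forall>Z\<in>entanglement_witnesses ds. hamiltonian ds Z \<and> entanglement_gap ds Z \<noteq> 0"
    using entanglement_witness_gap[OF assms(2)] by (metis less_irrefl)
qed

end
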